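(* Let $G$ be a graph with distinguishing number $D(G) = d$. If $\psi$ is a $d$-distinguishing labeling of $G$ with label classes of sizes $t_1 \leq \cdots \leq t_d$ such that $t_1 = \rho_d(G)$, then $$\mathrm{Det}(G) \leq \rho_d(G) + t_2 + \cdots + t_{d-1}.$$
   Context: Graphs are finite and simple. For a graph $G$ with vertex set $V(G)$, a labeling $\phi : V(G) \to \{1,\ldots,r\}$ is $r$-distinguishing if for every non-trivial automorphism $\sigma \in \mathrm{Aut}(G)$ there is a vertex $x$ with $\phi(x) \neq \phi(\sigma x)$. The distinguishing number $D(G)$ is the least positive integer $r$ such that $G$ has an $r$-distinguishing labeling. If $D(G) = d$, the cost of $d$-distinguishing $G$, denoted $\rho_d(G)$, is the minimum size of a label class in any $d$-distinguishing labeling of $G$ (minimum over all such labelings and all $d$ label classes). A subset $S \subseteq V(G)$ is a determining set for $G$ if whenever $g,h \in \mathrm{Aut}(G)$ satisfy $g(s) = h(s)$ for all $s \in S$, then $g = h$. The determining number $\mathrm{Det}(G)$ is the minimum cardinality of a determining set of $G$. The sum $t_2 + \cdots + t_{d-1}$ is empty (equal to $0$) when $d \leq 2$. *)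

theory Defs
  imports "Graph_Theory.Pair_Digraph" "HOL-Combinatorics.Permutations"
begin

(* A finite simple graph is a pair_graph: an undirected edge uv is the pair of arcs (u,v), (v,u).
   Since "permutes" makes a map the identity off the vertex set, the automorphisms below are
   determined by their action on the vertices, so equality of automorphisms is equality of
   functions, and the trivial automorphism is id. *)
definition graph_automorphism :: "'a pair_pre_digraph \<Rightarrow> ('a \<Rightarrow> 'a) \<Rightarrow> bool" where
  "graph_automorphism G \<sigma> \<longleftrightarrow> \<sigma> permutes pverts G \<and>
     (\<forall>u\<in>pverts G. \<forall>v\<in>pverts G. (u, v) \<in> parcs G \<longleftrightarrow> (\<sigma> u, \<sigma> v) \<in> parcs G)"

(* The values of a labeling off the vertex set are irrelevant; no label is required to be used. *)
definition distinguishing_labeling :: "'a pair_pre_digraph \<Rightarrow> nat \<Rightarrow> ('a \<Rightarrow> nat) \<Rightarrow> bool" where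
  "distinguishing_labeling G r \<phi> \<longleftrightarrow> \<phi> ` pverts G \<subseteq> {1..r} \<and>
     (\<forall>\<sigma>. graph_automorphism G \<sigma> \<and> \<sigma> \<noteq> id \<longrightarrow> (\<exists>x\<in>pverts G. \<phi> x \<noteq> \<phi> (\<sigma> x)))"

definition distinguishing_number :: "'a pair_pre_digraph \<Rightarrow> nat" where
  "distinguishing_number G = (LEAST r. 0 < r \<and> (\<exists>\<phi>. distinguishing_labeling G r \<phi>))"

definition label_class :: "'a pair_pre_digraph \<Rightarrow> ('a \<Rightarrow> nat) \<Rightarrow> nat \<Rightarrow> 'a set" where
  "label_class G \<phi> i = {x \<in> pverts G. \<phi> x = i}"

(* Meaningful only for d = distinguishing_number G. *)
definition distinguishing_cost :: "nat \<Rightarrow> 'a pair_pre_digraph \<Rightarrow> nat" where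
  "distinguishing_cost d G =
     (LEAST n. \<exists>\<phi>. distinguishing_labeling G d \<phi> \<and> (\<exists>i\<in>{1..d}. n = card (label_class G \<phi> i)))"

definition determining_set :: "'a pair_pre_digraph \<Rightarrow> 'a set \<Rightarrow> bool" where
  "determining_set G S \<longleftrightarrow> S \<subseteq> pverts G \<and>
     (\<forall>g h. graph_automorphism G g \<and> graph_automorphism G h \<and> (\<forall>s\<in>S. g s = h s) \<longrightarrow> g = h)"

definition determining_number :: "'a pair_pre_digraph \<Rightarrow> nat" where
  "determining_number G = (LEAST n. \<exists>S. determining_set G S \<and> card S = n)"

text \<open>The minima above are taken over nonempty sets.\<close>

lemma ex_determining_set: "determining_set G (pverts G)"
  by (auto simp: determining_set_def graph_automorphism_def permutes_def fun_eq_iff)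

lemma ex_distinguishing_labeling:
  assumes "pair_graph G"
  shows "\<exists>r>0. \<exists>\<phi>. distinguishing_labeling G r \<phi>"
proof -
  interpret pair_graph G by fact
  obtain f :: "'a \<Rightarrow> nat" where f: "inj_on f (pverts G)"
    using finite_imp_inj_to_nat_seg[OF pair_finite_verts] by metis
  obtain m where m: "\<forall>x\<in>pverts G. f x \<le> m"
    using finite_nat_set_iff_bounded_le[of "f ` pverts G"] pair_finite_verts by auto
  have "\<exists>x\<in>pverts G. Suc (f x) \<noteq> Suc (f (\<sigma> x))"
    if a: "graph_automorphism G \<sigma>" and ne: "\<sigma> \<noteq> id" for \<sigma>
  proof -
    have p: "\<sigma> permutes pverts G" using a by (simp add: graph_automorphism_def)
    obtain x where x: "\<sigma> x \<noteq> x" using ne by (auto simp: fun_eq_iff)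
    then have "x \<in> pverts G" using permutes_not_in[OF p] by blast
    moreover from this have "\<sigma> x \<in> pverts G" using permutes_in_image[OF p] by blast
    ultimately show ?thesis using x f by (metis inj_onD Suc_inject)
  qed
  then have "distinguishing_labeling G (Suc m) (\<lambda>x. Suc (f x))"
    using m by (auto simp: distinguishing_labeling_def)
  then show ?thesis by blast
qed

lemma distinguishing_number_attained:
  assumes "pair_graph G"
  shows "0 < distinguishing_number G"
    and "\<exists>\<phi>. distinguishing_labeling G (distinguishing_number G) \<phi>"
  using LeastI_ex[OF ex_distinguishing_labeling[OF assms]]
  unfolding distinguishing_number_def by blast+

lemma distinguishing_cost_attained:
  assumes "pair_graph G" and "d = distinguishing_number G"
  shows "\<exists>\<phi>. distinguishing_labeling G d \<phi> \<and>
    (\<exists>i\<in>{1..d}. distinguishing_cost d G = card (label_class G \<phi> i))"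
proof -
  obtain \<phi> where "distinguishing_labeling G d \<phi>" and "(1::nat) \<in> {1..d}"
    using distinguishing_number_attained[OF assms(1)] assms(2) by auto
  then have "\<exists>n \<phi>. distinguishing_labeling G d \<phi> \<and> (\<exists>i\<in>{1..d}. n = card (label_class G \<phi> i))"
    by blast
  then show ?thesis
    unfolding distinguishing_cost_def by (rule LeastI_ex)
qed

end

theory Submission
  imports Defs
begin

text \<open>
  An automorphism that fixes every vertex outside one label class can only permute the vertices
  inside that class, so it preserves all labels; if the labeling is distinguishing, it is trivial.
  Hence the complement of any single label class is a determining set
  (\<open>determining_set_complement_label_class\<close>). The bound comes from leaving out a largest class:
  the remaining vertices are covered by the other \<open>d - 1\<close> classes. For \<open>d \<ge> 2\<close> their sizes
  add up to \<open>\<rho>\<^sub>d(G) + t\<^sub>2 + \<dots> + t\<^sub>d\<^sub>-\<^sub>1\<close>; for \<open>d = 1\<close> nothing remains, the graph has no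
  nontrivial automorphism, and its determining number is \<open>0\<close>.
\<close>

lemma graph_automorphism_inv_comp:
  assumes g: "graph_automorphism G g" and h: "graph_automorphism G h"
  shows "graph_automorphism G (inv g \<circ> h)"
proof -
  have pg: "g permutes pverts G" and ph: "h permutes pverts G"
    using g h by (auto simp: graph_automorphism_def)
  have "(u, v) \<in> parcs G \<longleftrightarrow> (inv g (h u), inv g (h v)) \<in> parcs G"
    if "u \<in> pverts G" "v \<in> pverts G" for u v
  proof -
    have "h u \<in> pverts G" "h v \<in> pverts G"
      using that permutes_in_image[OF ph] by auto
    then have "inv g (h u) \<in> pverts G" "inv g (h v) \<in> pverts G"
      using permutes_in_image[OF permutes_inv[OF pg]] by auto
    then have "(inv g (h u), inv g (h v)) \<in> parcs G \<longleftrightarrow> (h u, h v) \<in> parcs G"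
      using g permutes_inverses(1)[OF pg] by (simp add: graph_automorphism_def)
    then show ?thesis
      using h that by (simp add: graph_automorphism_def)
  qed
  then show ?thesis
    using permutes_compose[OF ph permutes_inv[OF pg]] by (simp add: graph_automorphism_def)
qed

text \<open>
  Two automorphisms \<open>g\<close> and \<open>h\<close> agree on \<open>S\<close> exactly when \<open>g\<^sup>-\<^sup>1 h\<close> fixes \<open>S\<close> pointwise,
  so it is enough to test a set against the identity.
\<close>

lemma determining_setI:
  assumes "S \<subseteq> pverts G"
    and fix_id: "\<And>\<sigma>. graph_automorphism G \<sigma> \<Longrightarrow> \<forall>s\<in>S. \<sigma> s = s \<Longrightarrow> \<sigma> = id"
  shows "determining_set G S"
proof -
  have "g = h"
    if g: "graph_automorphism G g" and h: "graph_automorphism G h" and eq: "\<forall>s\<in>S. g s = h s"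
    for g h
  proof -
    have pg: "g permutes pverts G"
      using g by (simp add: graph_automorphism_def)
    have "\<forall>s\<in>S. (inv g \<circ> h) s = s"
      using eq permutes_inverses(2)[OF pg] by (metis comp_apply)
    then have "inv g \<circ> h = id"
      using fix_id graph_automorphism_inv_comp[OF g h] by blast
    then show "g = h"
      using permutes_inverses(1)[OF pg] by (metis comp_apply ext id_apply)
  qed
  then show ?thesis
    using assms(1) by (auto simp: determining_set_def)
qed

lemma determining_set_complement_label_class:
  assumes \<phi>: "distinguishing_labeling G r \<phi>"
  shows "determining_set G (pverts G - label_class G \<phi> c)"
proof (rule determining_setI)
  fix \<sigma>
  assume \<sigma>: "graph_automorphism G \<sigma>"
    and fixed: "\<forall>s\<in>pverts G - label_class G \<phi> c. \<sigma> s = s"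
  have p: "\<sigma> permutes pverts G"
    using \<sigma> by (simp add: graph_automorphism_def)
  have "\<phi> x = \<phi> (\<sigma> x)" if x: "x \<in> pverts G" for x
  proof (cases "\<sigma> x \<in> label_class G \<phi> c")
    case True
    then show ?thesis
      using fixed x by (cases "x \<in> label_class G \<phi> c") (auto simp: label_class_def)
  next
    case False
    \<comment> \<open>Now \<open>\<sigma> x\<close> is itself a fixed point, and injectivity brings this back to \<open>x\<close>.\<close>
    then have "\<sigma> (\<sigma> x) = \<sigma> x"
      using fixed permutes_in_image[OF p] x by blast
    then show ?thesis
      using permutes_inj[OF p] by (simp add: inj_eq)
  qed
  then show "\<sigma> = id"
    using \<phi> \<sigma> by (auto simp: distinguishing_labeling_def)
qed blast

lemma determining_number_le_card:
  "determining_set G S \<Longrightarrow> determining_number G \<le> card S"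
  unfolding determining_number_def by (rule Least_le) blast

theorem proposition2p4:
  fixes G :: "'a pair_pre_digraph" and d :: nat
    and \<psi> :: "'a \<Rightarrow> nat" and t :: "nat \<Rightarrow> nat" and \<pi> :: "nat \<Rightarrow> nat"
  assumes "pair_graph G"
    and "distinguishing_number G = d"
    and "distinguishing_labeling G d \<psi>"
    and "bij_betw \<pi> {1..d} {1..d}"
    and "\<forall>i\<in>{1..d}. t i = card (label_class G \<psi> (\<pi> i))"
    and "mono_on {1..d} t"
    and "t 1 = distinguishing_cost d G"
  shows "determining_number G \<le> distinguishing_cost d G + (\<Sum>i=2..d - 1. t i)"
proof -
  interpret pair_graph G by fact
  let ?S = "pverts G - label_class G \<psi> (\<pi> d)"
  let ?U = "\<Union>i\<in>{1..d - 1}. label_class G \<psi> (\<pi> i)"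
  have "?S \<subseteq> ?U"
  proof
    fix x
    assume x: "x \<in> ?S"
    then have "\<psi> x \<in> \<pi> ` {1..d}"
      using assms(3,4) by (auto simp: distinguishing_labeling_def bij_betw_def)
    then obtain i where i: "i \<in> {1..d}" "\<psi> x = \<pi> i"
      by blast
    moreover have "i \<noteq> d"
      using x i by (auto simp: label_class_def)
    ultimately show "x \<in> ?U"
      using x by (auto simp: label_class_def intro!: bexI[of _ i])
  qed
  moreover have "finite ?U"
    by (auto simp: label_class_def)
  ultimately have "card ?S \<le> card ?U"
    by (rule card_mono[rotated])
  also have "\<dots> \<le> (\<Sum>i=1..d - 1. card (label_class G \<psi> (\<pi> i)))"
    by (rule card_UN_le) simp
  also have "\<dots> = (\<Sum>i=1..d - 1. t i)"
    using assms(5) by (intro sum.cong) auto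
  \<comment> \<open>For \<open>d = 1\<close> the sum on the left is empty, so only an inequality holds here.\<close>
  also have "\<dots> \<le> t 1 + (\<Sum>i=2..d - 1. t i)"
    by (cases "1 \<le> d - 1") (simp_all add: sum.atLeast_Suc_atMost numeral_2_eq_2)
  finally have "card ?S \<le> distinguishing_cost d G + (\<Sum>i=2..d - 1. t i)"
    using assms(7) by simp
  moreover have "determining_number G \<le> card ?S"
    by (intro determining_number_le_card determining_set_complement_label_class[OF assms(3)])
  ultimately show ?thesis
    by simp
qed

end
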